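(* Let $t_0\in T$, let $\sigma_{\max}(t)$ be simple for all $t\ge t_0$, let $F$ be continuous, and let the Lipschitz condition $\|f(t,x)\|\le l(t)\|x\|$ hold for all $x\in\Omega_1$, $t\ge t_0$. Then for all sufficiently small $r_1>0$ (with $B_{r_1}\subset\Omega_1$), $\hat F\ge 0$ and $\delta_1>0$, with $t_1=t_0+\delta_1$, the following holds. For every $x_0\in B_{r_1}$, put $X_0=\|W^{-1}(t_0)x_0\|$. Then the solution $x(t,x_0)$ of $\dot x=A(t)x+f(t,x)+F(t)$, $x(t_0,x_0)=x_0$, satisfies $$\|x(t,x_0)\|\le X(t,X_0)=X_h(t,X_0)+X_{nh}(t),\qquad \forall t\in[t_0,t_1],$$ where $X(t,X_0)$ is the solution of the scalar linear initial value problem $$\dot X=\big(p(t)+k(t)l(t)\big)X+k(t)\|F(t)\|,\qquad X(t_0,X_0)=X_0,$$ and $$X_h(t,X_0)=\|W(t)\|\,\|W^{-1}(t_0)x_0\|\exp\Big(\int_{t_0}^t k(s)l(s)\,ds\Big),$$ $$X_{nh}(t)=\int_{t_0}^t\theta(t,\tau)k(\tau)\|F(\tau)\|\,d\tau,\qquad \theta(t,\tau)=\exp\Big(\int_\tau^t\big(p(s)+k(s)l(s)\big)ds\Big).$$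
   Context: $\|\cdot\|$ is the Euclidean norm on $\mathbb{R}^n$ and the induced spectral norm on matrices. $T=[\varsigma,\infty)$ with $\varsigma\in\mathbb{R}$, $t_0\in T$. Consider $\dot x=A(t)x+f(t,x)+F(t)$, $x\in\mathbb{R}^n$, $t\ge t_0$, where $A(t)\in\mathbb{R}^{n\times n}$, $f:[t_0,\infty)\times\mathbb{R}^n\to\mathbb{R}^n$ and $F:[t_0,\infty)\to\mathbb{R}^n$ are continuous, $f(t,0)=0$, and $F(t)=\hat F\phi(t)$ with $\|\phi(t)\|=1$ and a scalar $\hat F\ge0$. The solution $x(t,x_0)$ with $x(t_0,x_0)=x_0$ is assumed to be uniquely defined for all $t\ge t_0$ whenever $x_0$ lies in a fixed neighborhood of $0$ in $\mathbb{R}^n$. $W(t)$ is a fundamental solution matrix of $\dot x=A(t)x$ normalized so that $\|W(t_0)\|=1$; $\sigma_{\max}(t)$ and $\sigma_{\min}(t)$ are its largest and smallest singular values, and $\sigma_{\max}(t)$ is assumed to be simple for all $t\ge t_0$. Set $p(t)=\frac{d}{dt}\ln\|W(t)\|$ and $k(t)=\|W(t)\|\,\|W^{-1}(t)\|=\sigma_{\max}(t)/\sigma_{\min}(t)$. $\Omega_1\subset\mathbb{R}^n$ is a bounded neighborhood of $0$, and $l$ is a continuous function with $0<l(t)\le\hat l<\infty$ for all $t\ge t_0$. $B_r$ is the open ball of radius $r$ centered at $0$. *)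

theory Defs
  imports "HOL-Analysis.Analysis"
begin

text \<open>The library norm on the type of matrices is the Frobenius norm; the norm induced by the
  Euclidean norm is the operator norm of the associated linear map.\<close>

definition spectral_norm :: "real ^ 'n ^ 'm \<Rightarrow> real"
  where "spectral_norm M = onorm (\<lambda>v. M *v v)"

definition singular_value :: "real ^ 'n ^ 'm \<Rightarrow> real \<Rightarrow> bool"
  where "singular_value M \<sigma> \<longleftrightarrow>
    \<sigma> \<ge> 0 \<and> (\<exists>v. v \<noteq> 0 \<and> (transpose M ** M) *v v = \<sigma>\<^sup>2 *\<^sub>R v)"

definition sigma_max :: "real ^ 'n ^ 'm \<Rightarrow> real"
  where "sigma_max M = Max {\<sigma>. singular_value M \<sigma>}"

text \<open>The matrix \<open>transpose M ** M\<close> is symmetric, so the dimension of an eigenspace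
  is the multiplicity of the eigenvalue.\<close>

definition singular_value_multiplicity :: "real ^ 'n ^ 'm \<Rightarrow> real \<Rightarrow> nat"
  where "singular_value_multiplicity M \<sigma> = dim {v. (transpose M ** M) *v v = \<sigma>\<^sup>2 *\<^sub>R v}"

definition simple_singular_value :: "real ^ 'n ^ 'm \<Rightarrow> real \<Rightarrow> bool"
  where "simple_singular_value M \<sigma> \<longleftrightarrow>
    singular_value M \<sigma> \<and> singular_value_multiplicity M \<sigma> = 1"

definition condition_number :: "real ^ 'n ^ 'n \<Rightarrow> real"
  where "condition_number M = spectral_norm M * spectral_norm (matrix_inv M)"

text \<open>Differential equations live on a half-line; at its left endpoint \<open>at t within S\<close> gives the
  right derivative.\<close>

definition ivp_solution ::
  "real set \<Rightarrow> (real \<Rightarrow> 'a \<Rightarrow> 'a::real_normed_vector) \<Rightarrow> real \<Rightarrow> 'a \<Rightarrow> (real \<Rightarrow> 'a) \<Rightarrow> bool"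
  where "ivp_solution S g t0 u0 u \<longleftrightarrow>
    u t0 = u0 \<and> (\<forall>t\<in>S. (u has_vector_derivative g t (u t)) (at t within S))"

definition unique_ivp_solution ::
  "real set \<Rightarrow> (real \<Rightarrow> 'a \<Rightarrow> 'a::real_normed_vector) \<Rightarrow> real \<Rightarrow> 'a \<Rightarrow> (real \<Rightarrow> 'a) \<Rightarrow> bool"
  where "unique_ivp_solution S g t0 u0 u \<longleftrightarrow>
    ivp_solution S g t0 u0 u \<and>
    (\<forall>v. ivp_solution S g t0 u0 v \<longrightarrow> (\<forall>t\<in>S. v t = u t))"

definition fundamental_matrix ::
  "real set \<Rightarrow> (real \<Rightarrow> real ^ 'n ^ 'n) \<Rightarrow> (real \<Rightarrow> real ^ 'n ^ 'n) \<Rightarrow> bool"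
  where "fundamental_matrix S A W \<longleftrightarrow>
    (\<forall>t\<in>S. (W has_vector_derivative A t ** W t) (at t within S) \<and> invertible (W t))"

definition log_growth_rate :: "real \<Rightarrow> (real \<Rightarrow> real ^ 'n ^ 'n) \<Rightarrow> real \<Rightarrow> real"
  where "log_growth_rate t0 W t =
    vector_derivative (\<lambda>s. ln (spectral_norm (W s))) (at t within {t0..})"

definition X_h ::
  "real \<Rightarrow> (real \<Rightarrow> real ^ 'n ^ 'n) \<Rightarrow> (real \<Rightarrow> real) \<Rightarrow> real ^ 'n \<Rightarrow> real \<Rightarrow> real"
  where "X_h t0 W l x0 t =
    spectral_norm (W t) * norm (matrix_inv (W t0) *v x0) *
    exp (integral {t0..t} (\<lambda>s. condition_number (W s) * l s))"

definition theta ::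
  "real \<Rightarrow> (real \<Rightarrow> real ^ 'n ^ 'n) \<Rightarrow> (real \<Rightarrow> real) \<Rightarrow> real \<Rightarrow> real \<Rightarrow> real"
  where "theta t0 W l t \<tau> =
    exp (integral {\<tau>..t} (\<lambda>s. log_growth_rate t0 W s + condition_number (W s) * l s))"

definition X_nh ::
  "real \<Rightarrow> (real \<Rightarrow> real ^ 'n ^ 'n) \<Rightarrow> (real \<Rightarrow> real) \<Rightarrow> (real \<Rightarrow> real ^ 'n) \<Rightarrow> real \<Rightarrow> real"
  where "X_nh t0 W l F t =
    integral {t0..t} (\<lambda>\<tau>. theta t0 W l t \<tau> * condition_number (W \<tau>) * norm (F \<tau>))"

end

theory Submission
  imports Defs
begin

text \<open>Write \<open>\<sigma> t\<close> and \<open>\<kappa> t\<close> for the spectral norms of \<open>W t\<close> and its inverse, so that the condition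
  number is \<open>\<sigma> t * \<kappa> t\<close>, and put \<open>y = matrix_inv (W t) *v x\<close>. Since \<open>W\<close> is a fundamental matrix,
  the linear part cancels: \<open>y' = matrix_inv (W t) *v (f t x + F t)\<close>. While \<open>x\<close> stays in \<open>\<Omega>1\<close>, the
  inequalities \<open>norm x \<le> \<sigma> t * norm y\<close> and \<open>norm (f t x) \<le> l t * norm x\<close> give
  \<open>norm y' \<le> (\<sigma> t * \<kappa> t * l t) * norm y + \<kappa> t * norm (F t)\<close>. A Gronwall argument
  (\<open>norm_le_scalar_comparison\<close>) bounds \<open>norm y\<close> by the solution \<open>Y\<close> of the scalar linear equation
  with these coefficients and the initial value \<open>norm (y t0)\<close>, so \<open>norm x \<le> \<sigma> t * Y t\<close>.

  The product \<open>X = \<sigma> t * Y t\<close> is the function in the theorem. The factor \<open>\<sigma> t\<close> contributes its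
  logarithmic derivative \<open>p\<close> to the coefficient of \<open>X\<close>, and the explicit form is the sum of \<^const>\<open>X_h\<close>
  and \<^const>\<open>X_nh\<close>. Both claims require that \<open>\<sigma>\<close> is differentiable, which is the role of the simple
  largest singular value: the maximum defining \<open>\<sigma> t\<close> is attained at a single pair of opposite unit
  vectors, and this makes it differentiable (\<open>has_derivative_spectral_norm_power2\<close>). The function
  \<open>p\<close> enters only through its primitive \<open>ln (\<sigma> t)\<close>: the Henstock-Kurzweil integral of a derivative
  is the increment of its primitive, and the primitive is what integrating factors use.

  Finally \<open>X\<close> is at most a constant times the sum of the initial value \<open>norm (y t0)\<close> and the size
  of the forcing, uniformly on \<open>{t0..t0 + 1}\<close>. For small data it stays below the radius of a
  closed ball inside \<open>\<Omega>1\<close>, and then the solution cannot leave that ball before time \<open>t0 + 1\<close>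
  (\<open>solution_le_if_bound_in_\<Omega>\<close>).\<close>

section \<open>The spectral norm and its maximizing vectors\<close>

lemma bounded_bilinear_matrix_vector_mult:
  "bounded_bilinear (\<lambda>(M :: real ^ 'n ^ 'm) (v :: real ^ 'n). M *v v)"
  unfolding bilinear_conv_bounded_bilinear[symmetric] bilinear_def
  by (auto intro!: linearI simp: matrix_vector_mult_add_rdistrib matrix_vector_right_distrib
      matrix_vector_mult_scaleR scaleR_matrix_vector_assoc)

lemmas tendsto_matrix_vector_mult =
  bounded_bilinear.tendsto[OF bounded_bilinear_matrix_vector_mult]

lemmas continuous_on_matrix_vector_mult [continuous_intros] =
  bounded_bilinear.continuous_on[OF bounded_bilinear_matrix_vector_mult]

lemma norm_matrix_vector_mult_le: "norm (M *v v) \<le> spectral_norm M * norm v"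
  unfolding spectral_norm_def by (rule onorm) simp

lemma spectral_norm_nonneg: "0 \<le> spectral_norm M"
  unfolding spectral_norm_def by (rule onorm_pos_le) simp

lemma spectral_norm_attained:
  fixes M :: "real ^ 'n ^ 'm"
  obtains u where "norm u = 1" "norm (M *v u) = spectral_norm M"
proof -
  have "\<exists>u\<in>sphere 0 1. \<forall>v\<in>sphere 0 1. norm (M *v v) \<le> norm (M *v u)"
    by (rule continuous_attains_sup) (auto intro!: continuous_intros)
  then obtain u where u: "norm u = 1" and max: "\<And>v. norm v = 1 \<Longrightarrow> norm (M *v v) \<le> norm (M *v u)"
    by auto
  have "norm (M *v v) \<le> norm (M *v u) * norm v" for v
  proof (cases "v = 0")
    case False
    then show ?thesis
      using max[of "inverse (norm v) *\<^sub>R v"]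
      by (simp add: matrix_vector_mult_scaleR field_simps)
  qed simp
  then have "spectral_norm M \<le> norm (M *v u)"
    unfolding spectral_norm_def by (auto intro!: onorm_bound)
  with norm_matrix_vector_mult_le[of M u] u that show thesis by fastforce
qed

lemma inner_gram: "((transpose M ** M) *v v) \<bullet> w = (M *v v) \<bullet> (M *v w)"
  for M :: "real ^ 'n ^ 'm"
  by (metis dot_lmul_matrix matrix_vector_mul_assoc vector_transpose_matrix transpose_transpose)

text \<open>The quadratic form \<open>q w = s\<^sup>2 * (norm w)\<^sup>2 - (norm (M *v w))\<^sup>2\<close>, where \<open>s\<close> is the spectral
  norm, is positive semidefinite. A vector at which such a form vanishes lies in its kernel, since
  otherwise a small step from it in the direction opposite to the gradient would make the form
  negative.\<close>

lemma gram_eigenvector_of_maximizer: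
  fixes M :: "real ^ 'n ^ 'm"
  assumes "norm (M *v v) = spectral_norm M * norm v"
  shows "(transpose M ** M) *v v = (spectral_norm M)\<^sup>2 *\<^sub>R v"
proof -
  define s where "s = spectral_norm M"
  define q where "q w = s\<^sup>2 * (norm w)\<^sup>2 - (norm (M *v w))\<^sup>2" for w
  define z where "z = s\<^sup>2 *\<^sub>R v - (transpose M ** M) *v v"
  have q_nonneg: "q w \<ge> 0" for w
    using power_mono[OF norm_matrix_vector_mult_le[of M w], of 2]
    by (simp add: q_def s_def power_mult_distrib)
  have q0: "q v = 0"
    using assms by (simp add: q_def s_def power_mult_distrib)
  have cross: "s\<^sup>2 * (v \<bullet> z) - (M *v v) \<bullet> (M *v z) = z \<bullet> z"
    by (simp add: inner_gram[symmetric]) (simp add: z_def inner_diff_left)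
  have expand: "q (v + c *\<^sub>R z) = q v + 2 * c * (z \<bullet> z) + c\<^sup>2 * q z" for c
    unfolding cross[symmetric]
    by (simp add: q_def power2_norm_eq_inner matrix_vector_right_distrib matrix_vector_mult_scaleR
        inner_left_distrib inner_right_distrib inner_commute[of z v] inner_commute[of "M *v z" "M *v v"])
      (simp add: algebra_simps power2_eq_square)
  have "z \<bullet> z = 0"
  proof (rule ccontr)
    assume "z \<bullet> z \<noteq> 0"
    then have pos: "z \<bullet> z > 0" by simp
    \<comment> \<open>The quadratic \<open>2 * c * (z \<bullet> z) + c\<^sup>2 * q z\<close> is negative for small negative \<open>c\<close>. Adding 1 to
      \<open>q z\<close> avoids a division by zero and still leaves the linear term dominant.\<close>
    define c where "c = - (z \<bullet> z) / (q z + 1)"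
    have "c < 0" and c: "c * q z = - (z \<bullet> z) - c"
      using pos q_nonneg[of z] by (simp_all add: c_def field_simps)
    have "0 \<le> 2 * c * (z \<bullet> z) + c\<^sup>2 * q z"
      using expand[of c] q0 q_nonneg[of "v + c *\<^sub>R z"] by simp
    also have "\<dots> = c * (2 * (z \<bullet> z) + c * q z)"
      by (simp add: power2_eq_square algebra_simps)
    also have "\<dots> < 0"
      using pos \<open>c < 0\<close> unfolding c by (intro mult_neg_pos) linarith+
    finally show False by simp
  qed
  then show ?thesis by (simp add: z_def s_def)
qed

text \<open>Eigenvectors of the Gram matrix for different eigenvalues are orthogonal, hence linearly
  independent. Finiteness is what gives \<^const>\<open>Max\<close> in the definition of \<^const>\<open>sigma_max\<close> its meaning as a
  largest element.\<close>

lemma finite_singular_values: "finite {\<sigma>. singular_value M \<sigma>}"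
  for M :: "real ^ 'n ^ 'm"
proof -
  define G where "G = transpose M ** M"
  have "\<forall>\<sigma>\<in>{\<sigma>. singular_value M \<sigma>}. \<exists>v. v \<noteq> 0 \<and> G *v v = \<sigma>\<^sup>2 *\<^sub>R v"
    unfolding singular_value_def G_def by auto
  then obtain e where e: "\<And>\<sigma>. singular_value M \<sigma> \<Longrightarrow> e \<sigma> \<noteq> 0 \<and> G *v e \<sigma> = \<sigma>\<^sup>2 *\<^sub>R e \<sigma>"
    by (metis mem_Collect_eq)
  have orth: "e \<sigma> \<bullet> e \<tau> = 0"
    if "singular_value M \<sigma>" "singular_value M \<tau>" "\<sigma> \<noteq> \<tau>" for \<sigma> \<tau>
  proof -
    have "\<sigma>\<^sup>2 * (e \<sigma> \<bullet> e \<tau>) = \<tau>\<^sup>2 * (e \<sigma> \<bullet> e \<tau>)"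
      using inner_gram[of M "e \<sigma>" "e \<tau>"] inner_gram[of M "e \<tau>" "e \<sigma>"] e that
      by (simp add: G_def inner_commute)
    moreover have "\<sigma>\<^sup>2 \<noteq> \<tau>\<^sup>2"
      using that by (auto simp: singular_value_def power2_eq_iff_nonneg)
    ultimately show ?thesis by simp
  qed
  have "inj_on e {\<sigma>. singular_value M \<sigma>}"
    using orth e by (metis (mono_tags, lifting) inj_onI inner_eq_zero_iff mem_Collect_eq)
  moreover have "finite (e ` {\<sigma>. singular_value M \<sigma>})"
    using e orth
    by (intro independent_imp_finite pairwise_orthogonal_independent)
      (auto simp: pairwise_def orthogonal_def)
  ultimately show ?thesis using finite_imageD by blast
qed

lemma sigma_max_eq_spectral_norm: "sigma_max M = spectral_norm M" for M :: "real ^ 'n ^ 'm"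
  unfolding sigma_max_def
proof (rule Max_eqI[OF finite_singular_values])
  fix \<sigma> assume "\<sigma> \<in> {\<sigma>. singular_value M \<sigma>}"
  then obtain v where v: "\<sigma> \<ge> 0" "v \<noteq> 0" "(transpose M ** M) *v v = \<sigma>\<^sup>2 *\<^sub>R v"
    by (auto simp: singular_value_def)
  have "(norm (M *v v))\<^sup>2 = (\<sigma> * norm v)\<^sup>2"
    using inner_gram[of M v v] v by (simp add: power2_norm_eq_inner power_mult_distrib)
  then have "norm (M *v v) = \<sigma> * norm v"
    using v(1) by (simp add: power2_eq_iff_nonneg)
  then show "\<sigma> \<le> spectral_norm M"
    using norm_matrix_vector_mult_le[of M v] v(2) by simp
next
  obtain u where "norm u = 1" "norm (M *v u) = spectral_norm M" by (rule spectral_norm_attained)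
  then show "spectral_norm M \<in> {\<sigma>. singular_value M \<sigma>}"
    using gram_eigenvector_of_maximizer[of M u] spectral_norm_nonneg[of M]
    by (auto simp: singular_value_def intro!: exI[of _ u])
qed

text \<open>This is how simplicity of the largest singular value is used: all maximizing unit vectors
  lie in one eigenspace, which is a line.\<close>

lemma maximizer_unique_up_to_sign:
  fixes M :: "real ^ 'n ^ 'm"
  assumes simple: "simple_singular_value M (sigma_max M)"
    and u: "norm u = 1" "norm (M *v u) = spectral_norm M"
    and v: "norm v = 1" "norm (M *v v) = spectral_norm M"
  shows "v = u \<or> v = - u"
proof -
  define E where "E = {v. (transpose M ** M) *v v = (spectral_norm M)\<^sup>2 *\<^sub>R v}"
  have "subspace E"
    by (auto simp: subspace_def E_def matrix_vector_right_distrib matrix_vector_mult_scaleR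
        algebra_simps)
  have "dim E = 1"
    using simple
    by (simp add: simple_singular_value_def singular_value_multiplicity_def
        sigma_max_eq_spectral_norm E_def)
  have "u \<in> E" "v \<in> E"
    using gram_eigenvector_of_maximizer[of M] u v by (auto simp: E_def)
  have "u \<noteq> 0" using u by auto
  have "span {u} = E"
    using \<open>subspace E\<close> \<open>u \<in> E\<close> \<open>dim E = 1\<close> \<open>u \<noteq> 0\<close>
    by (intro subspace_dim_equal) (auto simp: span_minimal)
  then obtain c where c: "v = c *\<^sub>R u"
    using \<open>v \<in> E\<close> by (auto simp: span_singleton)
  then have "\<bar>c\<bar> = 1" using u v by simp
  then show ?thesis using c by (auto simp: abs_if split: if_splits)
qed

lemma spectral_norm_diff_le: "\<bar>spectral_norm M - spectral_norm N\<bar> \<le> spectral_norm (M - N)"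
  for M N :: "real ^ 'n ^ 'm"
proof -
  have le: "spectral_norm P \<le> spectral_norm Q + spectral_norm (P - Q)" for P Q :: "real ^ 'n ^ 'm"
    using onorm_triangle[of "\<lambda>v. Q *v v" "\<lambda>v. (P - Q) *v v"]
    by (simp add: spectral_norm_def matrix_vector_mult_diff_rdistrib bounded_linear_sub)
  have "spectral_norm (N - M) = spectral_norm (M - N)"
    using onorm_neg[of "\<lambda>v. (M - N) *v v"]
    by (simp add: spectral_norm_def matrix_vector_mult_diff_rdistrib)
  then show ?thesis using le[of M N] le[of N M] by linarith
qed

lemma tendsto_spectral_norm:
  fixes M :: "'a \<Rightarrow> real ^ 'n ^ 'm"
  assumes "(M \<longlongrightarrow> L) F"
  shows "((\<lambda>t. spectral_norm (M t)) \<longlongrightarrow> spectral_norm L) F"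
proof -
  obtain K where K: "\<And>(P :: real ^ 'n ^ 'm) v. norm (P *v v) \<le> norm P * norm v * K"
    using bounded_bilinear.bounded[OF bounded_bilinear_matrix_vector_mult] by blast
  have bound: "spectral_norm P \<le> K * norm P" for P :: "real ^ 'n ^ 'm"
    using K[of P] unfolding spectral_norm_def by (intro onorm_le) (simp add: algebra_simps)
  have "((\<lambda>t. K * norm (M t - L)) \<longlongrightarrow> 0) F"
    using assms by (auto intro!: tendsto_eq_intros)
  then have "((\<lambda>t. spectral_norm (M t) - spectral_norm L) \<longlongrightarrow> 0) F"
    by (rule Lim_null_comparison[rotated])
      (auto intro!: always_eventually order_trans[OF spectral_norm_diff_le bound])
  then show ?thesis by (simp add: LIM_zero_iff)
qed

lemma continuous_on_spectral_norm:
  "continuous_on S M \<Longrightarrow> continuous_on S (\<lambda>t. spectral_norm (M t))"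
  by (simp add: continuous_on_def tendsto_spectral_norm)

section \<open>Invertible matrices and continuity of the inverse\<close>

lemma invertible_matrix_inv:
  fixes M :: "real ^ 'n ^ 'n"
  assumes "invertible M"
  shows "M ** matrix_inv M = mat 1" "matrix_inv M ** M = mat 1"
  using someI_ex[OF assms[unfolded invertible_def]] by (simp_all add: matrix_inv_def)

lemma spectral_norm_pos:
  fixes M :: "real ^ 'n ^ 'n"
  assumes "invertible M"
  shows "0 < spectral_norm M"
proof (rule ccontr)
  assume "\<not> 0 < spectral_norm M"
  obtain u :: "real ^ 'n" where "norm u = 1" "norm (M *v u) = spectral_norm M"
    by (rule spectral_norm_attained)
  then have "M *v u = M *v 0" "u \<noteq> 0"
    using \<open>\<not> 0 < spectral_norm M\<close> spectral_norm_nonneg[of M] by auto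
  then show False using injD[OF inj_matrix_vector_mult[OF assms], of u 0] by simp
qed

lemma continuous_on_det:
  fixes M :: "real \<Rightarrow> real ^ 'n ^ 'n"
  assumes "continuous_on S M"
  shows "continuous_on S (\<lambda>t. det (M t))"
proof -
  have "continuous_on S (\<lambda>t. M t $ i $ j)" for i j
    using assms by (intro continuous_on_component)
  then show ?thesis
    unfolding det_def by (intro continuous_on_sum continuous_on_mult continuous_on_prod continuous_on_const)
qed

text \<open>By Cramer's rule, every entry of the inverse is a quotient of two determinants, and
  determinants are polynomials in the entries.\<close>

lemma continuous_on_matrix_inv:
  fixes M :: "real \<Rightarrow> real ^ 'n ^ 'n"
  assumes "continuous_on S M" and inv: "\<And>t. t \<in> S \<Longrightarrow> invertible (M t)"
  shows "continuous_on S (\<lambda>t. matrix_inv (M t))"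
proof -
  have entry: "matrix_inv (M t) $ k $ j =
      det (\<chi> i m. if m = k then (if i = j then 1 else 0) else M t $ i $ m) / det (M t)"
    if "t \<in> S" for t k j
  proof -
    have "M t *v (matrix_inv (M t) *v axis j 1) = axis j 1"
      by (simp add: matrix_vector_mul_assoc invertible_matrix_inv inv that)
    moreover have "det (M t) \<noteq> 0" using inv[OF that] by (simp add: invertible_det_nz)
    ultimately have "matrix_inv (M t) *v axis j 1 =
        (\<chi> k. det (\<chi> i m. if m = k then axis j 1 $ i else M t $ i $ m) / det (M t))"
      by (simp add: cramer)
    then have "(matrix_inv (M t) *v axis j 1) $ k =
        det (\<chi> i m. if m = k then (if i = j then 1 else 0) else M t $ i $ m) / det (M t)"
      by (simp add: axis_def if_distrib cong: if_cong)
    then show ?thesis by (simp add: matrix_vector_mult_basis column_def)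
  qed
  have entries: "continuous_on S (\<lambda>t. M t $ i $ j)" for i j
    using assms(1) by (intro continuous_on_component)
  have if_entries: "continuous_on S (\<lambda>t. if b then (c :: real) else M t $ i $ j)" for b c i j
    using entries by (cases b) auto
  have "continuous_on S (\<lambda>t. matrix_inv (M t) $ k $ j)" for k j
  proof -
    have "det (M t) \<noteq> 0" if "t \<in> S" for t using inv[OF that] by (simp add: invertible_det_nz)
    then have "continuous_on S (\<lambda>t.
        det (\<chi> i m. if m = k then (if i = j then 1 else 0) else M t $ i $ m) / det (M t))"
      using assms(1) by (auto intro!: continuous_on_divide continuous_on_det continuous_on_vec_lambda if_entries)
    then show ?thesis by (rule continuous_on_eq) (simp add: entry)
  qed
  then have "continuous_on S (\<lambda>t. \<chi> k j. matrix_inv (M t) $ k $ j)"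
    by (intro continuous_on_vec_lambda)
  then show ?thesis by simp
qed


section \<open>One-sided derivatives\<close>

lemma has_vector_derivative_iff_slope:
  "(f has_vector_derivative D) (at t within S) \<longleftrightarrow>
    ((\<lambda>\<tau>. (f \<tau> - f t) /\<^sub>R (\<tau> - t)) \<longlongrightarrow> D) (at t within S)"
proof -
  have "((\<lambda>\<tau>. norm (f \<tau> - f t - (\<tau> - t) *\<^sub>R D) / norm (\<tau> - t)) \<longlongrightarrow> 0) (at t within S)
    \<longleftrightarrow> ((\<lambda>\<tau>. norm ((f \<tau> - f t) /\<^sub>R (\<tau> - t) - D)) \<longlongrightarrow> 0) (at t within S)"
  proof (rule filterlim_cong)
    show "\<forall>\<^sub>F \<tau> in at t within S. norm (f \<tau> - f t - (\<tau> - t) *\<^sub>R D) / norm (\<tau> - t)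
        = norm ((f \<tau> - f t) /\<^sub>R (\<tau> - t) - D)"
      unfolding eventually_at_filter
    proof (intro always_eventually allI impI)
      fix \<tau> assume "\<tau> \<noteq> t"
      then have "(f \<tau> - f t) /\<^sub>R (\<tau> - t) - D = (f \<tau> - f t - (\<tau> - t) *\<^sub>R D) /\<^sub>R (\<tau> - t)"
        by (simp add: scaleR_diff_right)
      then show "norm (f \<tau> - f t - (\<tau> - t) *\<^sub>R D) / norm (\<tau> - t)
          = norm ((f \<tau> - f t) /\<^sub>R (\<tau> - t) - D)"
        by (simp add: divide_inverse mult.commute)
    qed
  qed simp_all
  then show ?thesis
    by (simp add: has_vector_derivative_def has_derivative_iff_norm bounded_linear_scaleR_left
        tendsto_norm_zero_iff LIM_zero_iff)
qed

lemma has_vector_derivative_integral_atLeast: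
  fixes g :: "real \<Rightarrow> 'a :: banach"
  assumes "continuous_on {a..} g" "a \<le> t"
  shows "((\<lambda>u. integral {a..u} g) has_vector_derivative g t) (at t within {a..})"
proof -
  have "((\<lambda>u. integral {a..u} g) has_vector_derivative g t) (at t within {a..t + 1})"
    using assms by (intro integral_has_vector_derivative) (auto intro: continuous_on_subset)
  moreover have "at t within {a..t + 1} = at t within {a..}"
    by (rule at_within_nhd[where S = "{..<t + 1}"]) auto
  ultimately show ?thesis by simp
qed

text \<open>Differentiating \<open>W \<tau> *v y \<tau> = x \<tau>\<close> by the product rule and solving for \<open>y'\<close> gives the
  formula. The same computation with difference quotients, combined with the continuity of the
  inverse, also proves that \<open>y\<close> is differentiable.\<close>

lemma has_vector_derivative_matrix_inv_mult:
  fixes W :: "real \<Rightarrow> real ^ 'n ^ 'n"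
  assumes W: "(W has_vector_derivative W') (at t within S)"
    and x: "(x has_vector_derivative x') (at t within S)"
    and cont: "continuous_on S W" and inv: "\<And>\<tau>. \<tau> \<in> S \<Longrightarrow> invertible (W \<tau>)" and "t \<in> S"
  shows "((\<lambda>\<tau>. matrix_inv (W \<tau>) *v x \<tau>) has_vector_derivative
    matrix_inv (W t) *v (x' - W' *v (matrix_inv (W t) *v x t))) (at t within S)"
proof -
  define y where "y \<tau> = matrix_inv (W \<tau>) *v x \<tau>" for \<tau>
  have Wy: "W \<tau> *v y \<tau> = x \<tau>" if "\<tau> \<in> S" for \<tau>
    using inv[OF that] by (simp add: y_def matrix_vector_mul_assoc invertible_matrix_inv)
  have invW: "matrix_inv (W \<tau>) *v (W \<tau> *v z) = z" if "\<tau> \<in> S" for \<tau> z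
    using inv[OF that] by (simp add: matrix_vector_mul_assoc invertible_matrix_inv)
  have slope: "matrix_inv (W \<tau>) *v ((x \<tau> - x t) /\<^sub>R (\<tau> - t) - ((W \<tau> - W t) /\<^sub>R (\<tau> - t)) *v y t) =
      (y \<tau> - y t) /\<^sub>R (\<tau> - t)" if "\<tau> \<in> S" for \<tau>
  proof -
    have "x \<tau> - x t - (W \<tau> - W t) *v y t = W \<tau> *v (y \<tau> - y t)"
      using Wy[OF that] Wy[OF \<open>t \<in> S\<close>]
      by (simp add: matrix_vector_mult_diff_rdistrib matrix_vector_mult_diff_distrib)
    then have "(x \<tau> - x t) /\<^sub>R (\<tau> - t) - ((W \<tau> - W t) /\<^sub>R (\<tau> - t)) *v y t =
        W \<tau> *v ((y \<tau> - y t) /\<^sub>R (\<tau> - t))"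
      by (simp add: matrix_vector_mult_scaleR scaleR_matrix_vector_assoc[symmetric]
          scaleR_diff_right[symmetric])
    then show ?thesis using invW[OF that] by simp
  qed
  have "((\<lambda>\<tau>. matrix_inv (W \<tau>)) \<longlongrightarrow> matrix_inv (W t)) (at t within S)"
    using continuous_on_matrix_inv[OF cont inv] \<open>t \<in> S\<close> by (simp add: continuous_on_def)
  then have "((\<lambda>\<tau>. matrix_inv (W \<tau>) *v
      ((x \<tau> - x t) /\<^sub>R (\<tau> - t) - ((W \<tau> - W t) /\<^sub>R (\<tau> - t)) *v y t))
      \<longlongrightarrow> matrix_inv (W t) *v (x' - W' *v y t)) (at t within S)"
    using W x unfolding has_vector_derivative_iff_slope
    by (intro tendsto_matrix_vector_mult tendsto_diff tendsto_const)
  then have "((\<lambda>\<tau>. (y \<tau> - y t) /\<^sub>R (\<tau> - t)) \<longlongrightarrow> matrix_inv (W t) *v (x' - W' *v y t)) (at t within S)"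
    by (rule Lim_transform_eventually)
      (use slope in \<open>auto simp: eventually_at_filter intro!: always_eventually\<close>)
  then show ?thesis
    unfolding has_vector_derivative_iff_slope y_def .
qed

section \<open>Differentiability of the spectral norm\<close>

text \<open>The square of the spectral norm is the maximum of \<open>(norm (W \<tau> *v v))\<^sup>2\<close> over unit vectors
  \<open>v\<close>, and a maximum of smooth functions is differentiable wherever all its maximizers give the
  same derivative (Danskin's theorem). Testing the maximum at time \<open>\<tau>\<close> with the maximizer \<open>u\<close> for
  time \<open>t\<close>, and the maximum at time \<open>t\<close> with a maximizer \<open>v \<tau>\<close> for time \<open>\<tau>\<close>, encloses its
  difference quotient between those of the two fixed vectors. By compactness, the vectors \<open>v \<tau>\<close>
  accumulate only at maximizers for time \<open>t\<close>, that is at \<open>u\<close> or \<open>- u\<close>, and the derivative is the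
  same at both because it is quadratic in the vector.\<close>

lemma has_derivative_spectral_norm_power2:
  fixes W :: "real \<Rightarrow> real ^ 'n ^ 'm"
  assumes W: "(W has_vector_derivative W') (at t within S)"
    and simple: "simple_singular_value (W t) (sigma_max (W t))"
    and u: "norm u = 1" "norm (W t *v u) = spectral_norm (W t)"
  shows "((\<lambda>\<tau>. (spectral_norm (W \<tau>))\<^sup>2) has_real_derivative 2 * ((W' *v u) \<bullet> (W t *v u)))
    (at t within S)"
proof -
  define D where "D \<tau> = (W \<tau> - W t) /\<^sub>R (\<tau> - t)" for \<tau>
  define q where "q \<tau> = ((spectral_norm (W \<tau>))\<^sup>2 - (spectral_norm (W t))\<^sup>2) / (\<tau> - t)" for \<tau>
  define B where "B v \<tau> = (D \<tau> *v v) \<bullet> (W \<tau> *v v + W t *v v)" for v \<tau>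
  define d where "d = 2 * ((W' *v u) \<bullet> (W t *v u))"
  have "\<forall>\<tau>. \<exists>v. norm v = 1 \<and> norm (W \<tau> *v v) = spectral_norm (W \<tau>)"
    by (meson spectral_norm_attained)
  then obtain v where v: "\<And>\<tau>. norm (v \<tau>) = 1" "\<And>\<tau>. norm (W \<tau> *v v \<tau>) = spectral_norm (W \<tau>)"
    by metis
  have B_eq: "B w \<tau> = ((norm (W \<tau> *v w))\<^sup>2 - (norm (W t *v w))\<^sup>2) / (\<tau> - t)" for w \<tau>
    unfolding B_def D_def
    by (simp add: scaleR_matrix_vector_assoc[symmetric] matrix_vector_mult_diff_rdistrib power2_norm_eq_inner inner_diff_left inner_right_distrib
        inner_commute[of "W t *v w" "W \<tau> *v w"] divide_inverse algebra_simps)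
  have le: "(norm (W \<tau> *v w))\<^sup>2 \<le> (spectral_norm (W \<tau>))\<^sup>2" if "norm w = 1" for w \<tau>
    using norm_matrix_vector_mult_le[of "W \<tau>" w] that by (intro power_mono) auto
  \<comment> \<open>The enclosure of \<open>q\<close> between the slopes of \<open>u\<close> and \<open>v \<tau>\<close> changes direction with the sign of
    \<open>\<tau> - t\<close>; this form of it does not.\<close>
  have sandwich: "\<bar>q \<tau> - d\<bar> \<le> \<bar>B u \<tau> - d\<bar> + \<bar>B (v \<tau>) \<tau> - d\<bar>" if "\<tau> \<noteq> t" for \<tau>
  proof (cases "\<tau> > t")
    case True
    then have "B u \<tau> \<le> q \<tau>" "q \<tau> \<le> B (v \<tau>) \<tau>"
      using le[OF u(1), of \<tau>] le[OF v(1)[of \<tau>], of t] u(2) v(2)[of \<tau>]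
      by (auto simp: B_eq q_def intro!: divide_right_mono)
    then show ?thesis by linarith
  next
    case False
    then have "q \<tau> \<le> B u \<tau>" "B (v \<tau>) \<tau> \<le> q \<tau>"
      using le[OF u(1), of \<tau>] le[OF v(1)[of \<tau>], of t] u(2) v(2)[of \<tau>] that
      by (auto simp: B_eq q_def intro!: divide_right_mono_neg)
    then show ?thesis by linarith
  qed
  have D: "(D \<longlongrightarrow> W') (at t within S)"
    using W unfolding has_vector_derivative_iff_slope D_def .
  have Wt: "(W \<longlongrightarrow> W t) (at t within S)"
    using has_vector_derivative_continuous[OF W] by (simp add: continuous_within)
  have "(q \<longlongrightarrow> d) (at t within S)"
    unfolding tendsto_at_iff_sequentially
  proof (intro allI impI, rule ccontr)
    fix T assume T: "\<forall>i. T i \<in> S - {t}" "T \<longlonglongrightarrow> t" and "\<not> (q \<circ> T) \<longlonglongrightarrow> d"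
    then obtain e where "e > 0" and e: "\<not> (\<forall>\<^sub>F n in sequentially. dist ((q \<circ> T) n) d < e)"
      unfolding tendsto_iff by blast
    obtain r :: "nat \<Rightarrow> nat" where r: "strict_mono r" "\<And>n. \<not> dist ((q \<circ> T) (r n)) d < e"
      using not_eventually_sequentiallyD[OF e] by metis
    obtain w r' where w: "w \<in> sphere 0 1" "strict_mono r'" "((\<lambda>n. v (T (r n))) \<circ> r') \<longlonglongrightarrow> w"
      using compact_sphere[of "0 :: real ^ 'n" 1] v(1) unfolding compact_def
      by (metis (no_types, lifting) dist_0_norm mem_sphere)
    define T' where "T' n = T (r (r' n))" for n
    have T': "T' n \<in> S - {t}" for n using T(1) by (simp add: T'_def)
    have "T' = T \<circ> (r \<circ> r')" by (auto simp: T'_def)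
    then have "T' \<longlonglongrightarrow> t"
      using LIMSEQ_subseq_LIMSEQ[OF T(2) strict_mono_o[OF r(1) w(2)]] by simp
    then have T'_at: "filterlim T' (at t within S) sequentially"
      using T' by (auto simp: filterlim_at intro!: always_eventually)
    have v_lim: "(\<lambda>n. v (T' n)) \<longlonglongrightarrow> w" using w(3) by (simp add: T'_def o_def)
    have D_lim: "(\<lambda>n. D (T' n)) \<longlonglongrightarrow> W'" by (rule filterlim_compose[OF D T'_at])
    have W_lim: "(\<lambda>n. W (T' n)) \<longlonglongrightarrow> W t" by (rule filterlim_compose[OF Wt T'_at])
    have "(\<lambda>n. norm (W (T' n) *v v (T' n))) \<longlonglongrightarrow> norm (W t *v w)"
      by (intro tendsto_norm tendsto_matrix_vector_mult W_lim v_lim)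
    moreover have "(\<lambda>n. norm (W (T' n) *v v (T' n))) \<longlonglongrightarrow> spectral_norm (W t)"
      unfolding v(2) by (intro tendsto_spectral_norm W_lim)
    ultimately have "norm (W t *v w) = spectral_norm (W t)" by (rule LIMSEQ_unique)
    then have "w = u \<or> w = - u"
      using maximizer_unique_up_to_sign[OF simple u] w(1) by simp
    moreover have twice: "a \<bullet> (b + b) = 2 * (a \<bullet> b)" for a b :: "real ^ 'm"
      by (metis inner_right_distrib mult_2)
    ultimately have w_limit: "(W' *v w) \<bullet> (W t *v w + W t *v w) = d"
      unfolding twice d_def by (auto simp: linear_neg[OF matrix_vector_mul_linear])
    have u_limit: "(W' *v u) \<bullet> (W t *v u + W t *v u) = d"
      unfolding twice d_def ..
    have "(\<lambda>n. B u (T' n)) \<longlonglongrightarrow> d"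
      unfolding B_def u_limit[symmetric]
      by (intro tendsto_inner tendsto_matrix_vector_mult tendsto_add tendsto_const D_lim W_lim)
    moreover have "(\<lambda>n. B (v (T' n)) (T' n)) \<longlonglongrightarrow> d"
      unfolding B_def w_limit[symmetric]
      by (intro tendsto_inner tendsto_matrix_vector_mult tendsto_add tendsto_const D_lim W_lim v_lim)
    ultimately have "(\<lambda>n. \<bar>B u (T' n) - d\<bar> + \<bar>B (v (T' n)) (T' n) - d\<bar>) \<longlonglongrightarrow> \<bar>d - d\<bar> + \<bar>d - d\<bar>"
      by (intro tendsto_intros)
    then have "\<forall>\<^sub>F n in sequentially. \<bar>B u (T' n) - d\<bar> + \<bar>B (v (T' n)) (T' n) - d\<bar> < e"
      using \<open>e > 0\<close> by (intro order_tendstoD(2)) auto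
    then obtain n where "\<bar>B u (T' n) - d\<bar> + \<bar>B (v (T' n)) (T' n) - d\<bar> < e"
      using eventually_happens' sequentially_bot by blast
    then have "\<bar>q (T' n) - d\<bar> < e" using sandwich[of "T' n"] T'[of n] by simp
    then show False using r(2)[of "r' n"] by (simp add: T'_def dist_real_def)
  qed
  then show ?thesis
    unfolding has_field_derivative_iff q_def d_def .
qed

lemma differentiable_ln_spectral_norm:
  fixes W :: "real \<Rightarrow> real ^ 'n ^ 'n"
  assumes "(W has_vector_derivative W') (at t within S)"
    and "simple_singular_value (W t) (sigma_max (W t))"
    and "invertible (W t)"
  shows "\<exists>p. ((\<lambda>\<tau>. ln (spectral_norm (W \<tau>))) has_vector_derivative p) (at t within S)"
proof -
  obtain u where u: "norm u = 1" "norm (W t *v u) = spectral_norm (W t)"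
    by (rule spectral_norm_attained)
  have "((\<lambda>\<tau>. ln ((spectral_norm (W \<tau>))\<^sup>2) / 2) has_real_derivative
      (1 / (spectral_norm (W t))\<^sup>2 * (2 * ((W' *v u) \<bullet> (W t *v u)))) / 2) (at t within S)"
    using spectral_norm_pos[OF assms(3)] assms
    by (intro DERIV_cdivide DERIV_chain'[where g = ln]
        has_derivative_spectral_norm_power2 u DERIV_ln_divide) auto
  moreover have "(\<lambda>\<tau>. ln ((spectral_norm (W \<tau>))\<^sup>2) / 2) = (\<lambda>\<tau>. ln (spectral_norm (W \<tau>)))"
    by (simp add: ln_realpow)
  ultimately show ?thesis
    unfolding has_real_derivative_iff_has_vector_derivative by auto
qed

section \<open>Comparison with a scalar linear equation\<close>

text \<open>The norm of \<open>y\<close> need not be differentiable where \<open>y\<close> vanishes. It is dominated by the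
  function \<open>R\<close>, which arises by integrating the bound on \<open>y'\<close>, and \<open>R\<close> is differentiable with
  \<open>R' \<le> \<alpha> R + \<beta>\<close>. Hence \<open>R - Y\<close>, multiplied by the integrating factor, is nonincreasing.\<close>

lemma norm_le_scalar_comparison:
  fixes y :: "real \<Rightarrow> 'a :: banach" and Y \<alpha> \<beta> :: "real \<Rightarrow> real"
  assumes y: "\<And>t. t \<in> {a..b} \<Longrightarrow> (y has_vector_derivative y' t) (at t within {a..b})"
    and bound: "\<And>t. t \<in> {a..b} \<Longrightarrow> norm (y' t) \<le> \<alpha> t * norm (y t) + \<beta> t"
    and cont: "continuous_on {a..b} \<alpha>" "continuous_on {a..b} \<beta>"
    and nonneg: "\<And>t. t \<in> {a..b} \<Longrightarrow> 0 \<le> \<alpha> t"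
    and Y: "\<And>t. t \<in> {a..b} \<Longrightarrow> (Y has_real_derivative \<alpha> t * Y t + \<beta> t) (at t within {a..b})"
    and init: "norm (y a) \<le> Y a"
    and t: "t \<in> {a..b}"
  shows "norm (y t) \<le> Y t"
proof -
  define R where "R t = norm (y a) + integral {a..t} (\<lambda>s. \<alpha> s * norm (y s) + \<beta> s)" for t
  define K where "K t = integral {a..t} \<alpha>" for t
  define h where "h t = exp (- K t) * (R t - Y t)" for t
  define h' where "h' t = exp (- K t) * (\<alpha> t * (norm (y t) - R t))" for t
  have "continuous_on {a..b} y"
    unfolding continuous_on_eq_continuous_within using has_vector_derivative_continuous[OF y] by blast
  then have rhs: "continuous_on {a..b} (\<lambda>s. \<alpha> s * norm (y s) + \<beta> s)"
    by (intro continuous_intros cont)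
  have le_R: "norm (y t) \<le> R t" if t: "t \<in> {a..b}" for t
  proof -
    have "(y' has_integral (y t - y a)) {a..t}"
      using t by (intro fundamental_theorem_of_calculus has_vector_derivative_within_subset[OF y]) auto
    then have y': "y' integrable_on {a..t}" "integral {a..t} y' = y t - y a"
      by (auto simp: integral_unique has_integral_integrable)
    have "norm (y t - y a) \<le> integral {a..t} (\<lambda>s. \<alpha> s * norm (y s) + \<beta> s)"
      using t bound unfolding y'(2)[symmetric]
      by (intro integral_norm_bound_integral y'(1) integrable_continuous_real continuous_on_subset[OF rhs]) auto
    then show ?thesis
      using norm_triangle_ineq2[of "y t" "y a"] unfolding R_def by linarith
  qed
  have h': "(h has_real_derivative h' t) (at t within {a..b})" if t: "t \<in> {a..b}" for t
  proof -
    have K: "(K has_real_derivative \<alpha> t) (at t within {a..b})"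
      unfolding K_def by (rule integral_has_real_derivative[OF cont(1) t])
    have R: "(R has_real_derivative \<alpha> t * norm (y t) + \<beta> t) (at t within {a..b})"
      unfolding R_def by (auto intro!: derivative_eq_intros integral_has_real_derivative[OF rhs t])
    show ?thesis
      unfolding h_def h'_def
      by (rule derivative_eq_intros K R Y[OF t] refl)+ (simp add: algebra_simps)
  qed
  have "(h' has_integral (h t - h a)) {a..t}"
  proof (rule fundamental_theorem_of_calculus)
    show "(h has_vector_derivative h' s) (at s within {a..t})" if "s \<in> {a..t}" for s
      unfolding has_real_derivative_iff_has_vector_derivative[symmetric]
      using t that by (intro DERIV_subset[OF h']) auto
  qed (use t in auto)
  then have "h t - h a \<le> 0"
    by (rule has_integral_le[OF _ has_integral_0])
      (use t le_R nonneg in \<open>auto simp: h'_def mult_le_0_iff\<close>)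
  moreover have "h a \<le> 0" using init by (simp add: h_def R_def K_def)
  ultimately have "h t \<le> 0" by linarith
  then have "R t \<le> Y t" by (simp add: h_def mult_le_0_iff)
  then show ?thesis using le_R[OF t] by simp
qed


lemma continuous_on_interval_bound:
  fixes g :: "real \<Rightarrow> real"
  assumes "continuous_on {a..b} g"
  obtains M where "M > 0" "\<And>t. t \<in> {a..b} \<Longrightarrow> g t \<le> M"
proof -
  have "bounded (g ` {a..b})"
    using assms by (intro compact_imp_bounded compact_continuous_image) auto
  then obtain M where "M > 0" and M: "\<forall>z\<in>g ` {a..b}. norm z \<le> M" unfolding bounded_pos by blast
  have "g t \<le> M" if "t \<in> {a..b}" for t
    using bspec[OF M imageI[OF that]] by simp
  then show thesis using that[OF \<open>M > 0\<close>] by blast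
qed

section \<open>The scalar majorant in transformed coordinates\<close>

text \<open>In the coordinates \<open>y = matrix_inv (W t) *v x\<close> the linear part of the equation disappears,
  and the right-hand side of the equation for \<open>Y\<close>, evaluated at \<open>norm y\<close>, bounds \<open>norm y'\<close>. The
  majorant of \<open>x\<close> is the spectral norm of \<open>W t\<close> times \<open>Y\<close>.\<close>

locale simple_fundamental_solution =
  fixes t0 :: real and A W :: "real \<Rightarrow> real ^ 'n ^ 'n" and l :: "real \<Rightarrow> real"
  assumes fundamental: "fundamental_matrix {t0..} A W"
    and simple: "\<And>t. t \<ge> t0 \<Longrightarrow> simple_singular_value (W t) (sigma_max (W t))"
    and continuous_l: "continuous_on {t0..} l"
    and l_nonneg: "\<And>t. t \<ge> t0 \<Longrightarrow> 0 \<le> l t"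
begin

abbreviation \<sigma> :: "real \<Rightarrow> real" where "\<sigma> t \<equiv> spectral_norm (W t)"
abbreviation \<kappa> :: "real \<Rightarrow> real" where "\<kappa> t \<equiv> spectral_norm (matrix_inv (W t))"
abbreviation p :: "real \<Rightarrow> real" where "p \<equiv> log_growth_rate t0 W"

text \<open>The accumulated Lipschitz growth: the exponent in \<^const>\<open>X_h\<close>.\<close>

definition K :: "real \<Rightarrow> real"
  where "K t = integral {t0..t} (\<lambda>s. condition_number (W s) * l s)"

text \<open>The solution of \<open>Y' = (condition_number (W t) * l t) * Y + \<kappa> t * norm (F t)\<close> with initial
  value \<open>c\<close>, written by variation of constants.\<close>

definition Y :: "(real \<Rightarrow> real ^ 'n) \<Rightarrow> real \<Rightarrow> real \<Rightarrow> real"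
  where "Y F c t = exp (K t) * (c + integral {t0..t} (\<lambda>\<tau>. exp (- K \<tau>) * \<kappa> \<tau> * norm (F \<tau>)))"

lemma W_derivative: "t \<ge> t0 \<Longrightarrow> (W has_vector_derivative A t ** W t) (at t within {t0..})"
  and W_invertible: "t \<ge> t0 \<Longrightarrow> invertible (W t)"
  using fundamental by (auto simp: fundamental_matrix_def)

lemma \<sigma>_pos: "t \<ge> t0 \<Longrightarrow> 0 < \<sigma> t"
  by (simp add: spectral_norm_pos W_invertible)

lemma continuous_W: "continuous_on {t0..} W"
  unfolding continuous_on_eq_continuous_within
  using has_vector_derivative_continuous[OF W_derivative] by simp

lemma continuous_\<sigma>: "continuous_on {t0..} \<sigma>"
  by (rule continuous_on_spectral_norm[OF continuous_W])

lemma continuous_\<kappa>: "continuous_on {t0..} \<kappa>"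
  by (intro continuous_on_spectral_norm continuous_on_matrix_inv continuous_W) (simp add: W_invertible)

lemma continuous_rate: "continuous_on {t0..} (\<lambda>t. condition_number (W t) * l t)"
  unfolding condition_number_def
  by (intro continuous_intros continuous_\<sigma> continuous_\<kappa> continuous_l)

lemma rate_nonneg: "t \<ge> t0 \<Longrightarrow> 0 \<le> condition_number (W t) * l t"
  by (simp add: condition_number_def spectral_norm_nonneg l_nonneg)

lemma K_derivative:
  assumes "t \<ge> t0"
  shows "(K has_real_derivative condition_number (W t) * l t) (at t within {t0..})"
  using has_vector_derivative_integral_atLeast[OF continuous_rate assms]
  unfolding K_def has_real_derivative_iff_has_vector_derivative .

lemma continuous_K: "continuous_on {t0..} K"
  using K_derivative by (intro DERIV_continuous_on) auto

lemma K_nonneg: "t \<ge> t0 \<Longrightarrow> 0 \<le> K t"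
  unfolding K_def using rate_nonneg
  by (intro integral_nonneg integrable_continuous_real continuous_on_subset[OF continuous_rate]) auto

lemma continuous_forcing:
  fixes F :: "real \<Rightarrow> real ^ 'n"
  assumes "continuous_on {t0..} F"
  shows "continuous_on {t0..} (\<lambda>\<tau>. exp (- K \<tau>) * \<kappa> \<tau> * norm (F \<tau>))"
  by (intro continuous_intros assms continuous_K continuous_\<kappa>)

lemma Y_derivative:
  assumes F: "continuous_on {t0..} F" and t: "t \<ge> t0"
  shows "(Y F c has_real_derivative
    condition_number (W t) * l t * Y F c t + \<kappa> t * norm (F t)) (at t within {t0..})"
proof -
  have "((\<lambda>t. integral {t0..t} (\<lambda>\<tau>. exp (- K \<tau>) * \<kappa> \<tau> * norm (F \<tau>))) has_real_derivative
      exp (- K t) * \<kappa> t * norm (F t)) (at t within {t0..})"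
    using has_vector_derivative_integral_atLeast[OF continuous_forcing[OF F] t]
    unfolding has_real_derivative_iff_has_vector_derivative .
  then have "(Y F c has_real_derivative
      exp (K t) * (0 + exp (- K t) * \<kappa> t * norm (F t)) + exp (K t) * (condition_number (W t) * l t) *
        (c + integral {t0..t} (\<lambda>\<tau>. exp (- K \<tau>) * \<kappa> \<tau> * norm (F \<tau>)))) (at t within {t0..})"
    unfolding Y_def by (auto intro!: derivative_eq_intros K_derivative[OF t])
  then show ?thesis
    by (rule DERIV_cong) (simp add: Y_def exp_minus)
qed

text \<open>Without differentiability of the spectral norm, \<^const>\<open>log_growth_rate\<close> would be an arbitrary
  value of a choice operator; this is where the simplicity of the largest singular value enters
  the scalar equation.\<close>

lemma ln_\<sigma>_derivative:
  assumes "t \<ge> t0"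
  shows "((\<lambda>t. ln (\<sigma> t)) has_real_derivative p t) (at t within {t0..})"
proof -
  obtain d where d: "((\<lambda>t. ln (\<sigma> t)) has_vector_derivative d) (at t within {t0..})"
    using differentiable_ln_spectral_norm[OF W_derivative simple W_invertible] assms by blast
  have "at t within {t..t + 1} \<noteq> bot" by (simp add: at_within_Icc_at_right)
  then have "at t within {t0..} \<noteq> bot"
    using at_le[of "{t..t + 1}" "{t0..}" t] assms by (auto simp: bot_unique)
  then have "p t = d"
    unfolding log_growth_rate_def using d by (rule vector_derivative_within)
  then show ?thesis
    using d by (simp add: has_real_derivative_iff_has_vector_derivative)
qed

lemma integrating_factor_derivative:
  assumes "t \<ge> t0"
  shows "((\<lambda>t. ln (\<sigma> t) + K t) has_real_derivative p t + condition_number (W t) * l t)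
    (at t within {t0..})"
  by (intro DERIV_add ln_\<sigma>_derivative K_derivative assms)

text \<open>The integrand in the exponent is the derivative of \<open>ln (\<sigma> s) + K s\<close>, and the
  Henstock-Kurzweil integral of a derivative is the increment of its primitive.\<close>

lemma theta_eq:
  assumes "t0 \<le> \<tau>" "\<tau> \<le> t"
  shows "theta t0 W l t \<tau> = \<sigma> t / \<sigma> \<tau> * exp (K t - K \<tau>)"
proof -
  have "((\<lambda>s. p s + condition_number (W s) * l s) has_integral
      ((ln (\<sigma> t) + K t) - (ln (\<sigma> \<tau>) + K \<tau>))) {\<tau>..t}"
  proof (rule fundamental_theorem_of_calculus)
    show "((\<lambda>s. ln (\<sigma> s) + K s) has_vector_derivative p s + condition_number (W s) * l s)
        (at s within {\<tau>..t})" if "s \<in> {\<tau>..t}" for s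
      unfolding has_real_derivative_iff_has_vector_derivative[symmetric]
      using assms that by (intro DERIV_subset[OF integrating_factor_derivative]) auto
  qed (use assms in auto)
  then show ?thesis
    using \<sigma>_pos[of t] \<sigma>_pos[of \<tau>] assms
    by (simp add: theta_def integral_unique exp_diff exp_add)
qed

lemma X_eq_\<sigma>_times_Y:
  assumes "t \<ge> t0"
  shows "X_h t0 W l x0 t + X_nh t0 W l F t = \<sigma> t * Y F (norm (matrix_inv (W t0) *v x0)) t"
proof -
  have "theta t0 W l t \<tau> * condition_number (W \<tau>) * norm (F \<tau>) =
      (\<sigma> t * exp (K t)) * (exp (- K \<tau>) * \<kappa> \<tau> * norm (F \<tau>))" if "\<tau> \<in> {t0..t}" for \<tau>
    using that \<sigma>_pos[of \<tau>] by (simp add: theta_eq condition_number_def exp_diff exp_minus field_simps)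
  then have "X_nh t0 W l F t =
      integral {t0..t} (\<lambda>\<tau>. (\<sigma> t * exp (K t)) * (exp (- K \<tau>) * \<kappa> \<tau> * norm (F \<tau>)))"
    unfolding X_nh_def by (intro integral_cong)
  also have "\<dots> = (\<sigma> t * exp (K t)) * integral {t0..t} (\<lambda>\<tau>. exp (- K \<tau>) * \<kappa> \<tau> * norm (F \<tau>))"
    by (rule integral_mult_right)
  finally show ?thesis
    by (simp add: X_h_def Y_def K_def algebra_simps)
qed

text \<open>Multiplying \<open>Y\<close> by \<open>\<sigma> t = exp (ln (\<sigma> t))\<close> adds \<open>p t\<close> to the linear coefficient. For
  uniqueness, the difference of two solutions, divided by the solution \<open>exp (ln (\<sigma> t) + K t)\<close> of
  the homogeneous equation, has derivative zero. The normalization of \<open>W t0\<close> matches the two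
  initial values.\<close>

lemma unique_ivp_solution_\<sigma>_times_Y:
  assumes F: "continuous_on {t0..} F" and "\<sigma> t0 = 1"
  shows "unique_ivp_solution {t0..}
    (\<lambda>t X. (p t + condition_number (W t) * l t) * X + condition_number (W t) * norm (F t))
    t0 c (\<lambda>t. \<sigma> t * Y F c t)"
  unfolding unique_ivp_solution_def ivp_solution_def
proof (intro conjI allI impI ballI)
  let ?X = "\<lambda>t. \<sigma> t * Y F c t"
  show "?X t0 = c" using \<open>\<sigma> t0 = 1\<close> by (simp add: Y_def K_def)
  have X: "(?X has_real_derivative (p t + condition_number (W t) * l t) * ?X t
      + condition_number (W t) * norm (F t)) (at t within {t0..})" if t: "t \<ge> t0" for t
  proof -
    have "((\<lambda>t. exp (ln (\<sigma> t)) * Y F c t) has_real_derivative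
        exp (ln (\<sigma> t)) * (condition_number (W t) * l t * Y F c t + \<kappa> t * norm (F t)) +
        exp (ln (\<sigma> t)) * p t * Y F c t) (at t within {t0..})"
      by (rule DERIV_cong[OF DERIV_mult[OF DERIV_chain2[OF DERIV_exp ln_\<sigma>_derivative[OF t]]
            Y_derivative[OF F t]]]) (simp add: algebra_simps)
    then have "(?X has_real_derivative
        exp (ln (\<sigma> t)) * (condition_number (W t) * l t * Y F c t + \<kappa> t * norm (F t)) +
        exp (ln (\<sigma> t)) * p t * Y F c t) (at t within {t0..})"
      by (rule has_field_derivative_transform_within[OF _ zero_less_one]) (use t \<sigma>_pos in auto)
    then show ?thesis
      using \<sigma>_pos[OF t] by (elim DERIV_cong) (simp add: condition_number_def algebra_simps)
  qed
  show "(?X has_vector_derivative (p t + condition_number (W t) * l t) * ?X t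
      + condition_number (W t) * norm (F t)) (at t within {t0..})" if "t \<in> {t0..}" for t
    using X[of t] that by (simp add: has_real_derivative_iff_has_vector_derivative)
  fix Z t
  assume Z: "Z t0 = c \<and> (\<forall>t\<in>{t0..}. (Z has_vector_derivative
      (p t + condition_number (W t) * l t) * Z t + condition_number (W t) * norm (F t))
      (at t within {t0..}))" and t: "t \<in> {t0..}"
  define d where "d t = exp (- (ln (\<sigma> t) + K t)) * (Z t - ?X t)" for t
  have "(d has_real_derivative 0) (at t within {t0..})" if t: "t \<ge> t0" for t
  proof -
    have Z': "(Z has_real_derivative
        (p t + condition_number (W t) * l t) * Z t + condition_number (W t) * norm (F t))
        (at t within {t0..})"
      using Z t by (simp add: has_real_derivative_iff_has_vector_derivative)
    show ?thesis
      unfolding d_def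
      by (rule derivative_eq_intros integrating_factor_derivative[OF t] X[OF t] Z' refl)+
        (simp add: algebra_simps)
  qed
  then have "\<exists>e. \<forall>t\<in>{t0..}. d t = e"
    by (intro has_field_derivative_zero_constant) auto
  then have "d t = d t0" using t by auto
  also have "\<dots> = 0" using Z \<open>?X t0 = c\<close> by (simp add: d_def)
  finally show "Z t = ?X t" by (simp add: d_def)
qed

text \<open>The choice of \<open>B\<close> precedes that of the forcing term and of the initial value, so one
  smallness condition serves all of them. On \<open>{t0..t0 + 1}\<close>, \<open>\<sigma>\<close>, \<open>\<kappa>\<close> and \<open>K\<close> are bounded by
  constants \<open>S\<close>, \<open>C\<close> and \<open>M\<close>, and the majorant depends linearly on the initial value and the
  forcing.\<close>

lemma \<sigma>_times_Y_bound:
  "\<exists>B>0. \<forall>F Fhat c t. continuous_on {t0..} F \<longrightarrow> (\<forall>\<tau>\<ge>t0. norm (F \<tau>) \<le> Fhat) \<longrightarrow> 0 \<le> c \<longrightarrow>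
    t \<in> {t0..t0 + 1} \<longrightarrow> \<sigma> t * Y F c t \<le> B * (c + Fhat)"
proof -
  have sub: "{t0..t0 + 1} \<subseteq> {t0..}" by auto
  obtain S where S: "S > 0" "\<And>t. t \<in> {t0..t0 + 1} \<Longrightarrow> \<sigma> t \<le> S"
    using continuous_on_interval_bound[OF continuous_on_subset[OF continuous_\<sigma> sub]] by blast
  obtain C where C: "C > 0" "\<And>t. t \<in> {t0..t0 + 1} \<Longrightarrow> \<kappa> t \<le> C"
    using continuous_on_interval_bound[OF continuous_on_subset[OF continuous_\<kappa> sub]] by blast
  obtain M where M: "M > 0" "\<And>t. t \<in> {t0..t0 + 1} \<Longrightarrow> K t \<le> M"
    using continuous_on_interval_bound[OF continuous_on_subset[OF continuous_K sub]] by blast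
  have "\<sigma> t * Y F c t \<le> S * exp M * (1 + C) * (c + Fhat)"
    if F: "continuous_on {t0..} F" "\<And>\<tau>. \<tau> \<ge> t0 \<Longrightarrow> norm (F \<tau>) \<le> Fhat" and "0 \<le> c"
      and t: "t \<in> {t0..t0 + 1}" for F Fhat c t
  proof -
    have "Fhat \<ge> 0" using F(2)[of t0] norm_ge_zero[of "F t0"] by linarith
    define I where "I = integral {t0..t} (\<lambda>\<tau>. exp (- K \<tau>) * \<kappa> \<tau> * norm (F \<tau>))"
    have "exp (- K \<tau>) * \<kappa> \<tau> * norm (F \<tau>) \<le> 1 * C * Fhat" if "\<tau> \<in> {t0..t}" for \<tau>
      using that t C(2)[of \<tau>] C(1) F(2)[of \<tau>] K_nonneg[of \<tau>]
      by (intro mult_mono) (auto simp: spectral_norm_nonneg)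
    then have "I \<le> integral {t0..t} (\<lambda>_. C * Fhat)"
      unfolding I_def
      by (intro integral_le integrable_continuous_real continuous_on_subset[OF continuous_forcing[OF F(1)]])
        auto
    also have "\<dots> = (t - t0) * (C * Fhat)" using t by simp
    also have "\<dots> \<le> 1 * (C * Fhat)"
      using t C(1) \<open>Fhat \<ge> 0\<close> by (intro mult_right_mono) auto
    finally have I_le: "I \<le> C * Fhat" by simp
    have I_nonneg: "0 \<le> I"
      unfolding I_def
      by (intro integral_nonneg integrable_continuous_real continuous_on_subset[OF continuous_forcing[OF F(1)]])
        (auto simp: spectral_norm_nonneg)
    have "\<sigma> t * Y F c t = \<sigma> t * exp (K t) * (c + I)" by (simp add: Y_def I_def)
    also have "\<dots> \<le> S * exp M * (c + C * Fhat)"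
      using S M t I_le I_nonneg \<open>0 \<le> c\<close>
      by (intro mult_mono add_mono) (auto simp: spectral_norm_nonneg)
    also have "\<dots> \<le> S * exp M * ((1 + C) * (c + Fhat))"
      using S(1) C(1) \<open>0 \<le> c\<close> \<open>Fhat \<ge> 0\<close> by (intro mult_left_mono) (auto simp: algebra_simps)
    finally show ?thesis by (simp add: mult.assoc)
  qed
  moreover have "S * exp M * (1 + C) > 0" using S(1) C(1) by simp
  ultimately show ?thesis by blast
qed

section \<open>Solutions stay below the majorant\<close>

context
  fixes f :: "real \<Rightarrow> real ^ 'n \<Rightarrow> real ^ 'n" and F x :: "real \<Rightarrow> real ^ 'n"
    and x0 :: "real ^ 'n" and \<Omega> :: "(real ^ 'n) set"
  assumes F: "continuous_on {t0..} F"
    and x: "ivp_solution {t0..} (\<lambda>t y. A t *v y + f t y + F t) t0 x0 x"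
    and lipschitz: "\<And>t y. t \<ge> t0 \<Longrightarrow> y \<in> \<Omega> \<Longrightarrow> norm (f t y) \<le> l t * norm y"
begin

text \<open>Differentiating \<open>y = matrix_inv (W t) *v x\<close> leaves \<open>matrix_inv (W t) *v (f t x + F t)\<close>. As
  long as the Lipschitz bound applies, \<open>norm (f t x) \<le> l t * \<sigma> t * norm y\<close>, and the product of
  \<open>\<sigma> t\<close> with the norm \<open>\<kappa> t\<close> of the inverse is the condition number.\<close>

lemma solution_le_while_in_\<Omega>:
  assumes in_\<Omega>: "\<And>s. s \<in> {t0..b} \<Longrightarrow> x s \<in> \<Omega>" and t: "t \<in> {t0..b}"
  shows "norm (x t) \<le> \<sigma> t * Y F (norm (matrix_inv (W t0) *v x0)) t"
proof -
  define y where "y t = matrix_inv (W t) *v x t" for t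
  define c where "c = norm (matrix_inv (W t0) *v x0)"
  have Wy: "W t *v y t = x t" if "t \<ge> t0" for t
    using W_invertible[OF that] by (simp add: y_def matrix_vector_mul_assoc invertible_matrix_inv)
  have y: "(y has_vector_derivative matrix_inv (W t) *v (f t (x t) + F t)) (at t within {t0..})"
    if t: "t \<ge> t0" for t
  proof -
    have "(x has_vector_derivative A t *v x t + f t (x t) + F t) (at t within {t0..})"
      using x t by (simp add: ivp_solution_def)
    moreover have "A t *v x t + f t (x t) + F t - (A t ** W t) *v y t = f t (x t) + F t"
      by (simp add: matrix_vector_mul_assoc[symmetric] Wy[OF t])
    ultimately show ?thesis
      using has_vector_derivative_matrix_inv_mult[OF W_derivative[OF t] _ continuous_W, of x] t
        W_invertible
      unfolding y_def by fastforce
  qed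
  have "norm (matrix_inv (W t) *v (f t (x t) + F t)) \<le>
      condition_number (W t) * l t * norm (y t) + \<kappa> t * norm (F t)" if "t \<in> {t0..b}" for t
  proof -
    have "norm (x t) \<le> \<sigma> t * norm (y t)"
      using norm_matrix_vector_mult_le[of "W t" "y t"] Wy[of t] that by simp
    then have "norm (f t (x t)) \<le> l t * (\<sigma> t * norm (y t))"
      using lipschitz[OF _ in_\<Omega>, of t] l_nonneg[of t] that
      by (auto intro: order_trans mult_left_mono)
    then have "norm (f t (x t) + F t) \<le> l t * (\<sigma> t * norm (y t)) + norm (F t)"
      by (intro norm_triangle_le add_mono) auto
    then have "\<kappa> t * norm (f t (x t) + F t) \<le> \<kappa> t * (l t * (\<sigma> t * norm (y t)) + norm (F t))"
      by (intro mult_left_mono) (auto simp: spectral_norm_nonneg)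
    then show ?thesis
      using norm_matrix_vector_mult_le[of "matrix_inv (W t)" "f t (x t) + F t"]
      by (simp add: condition_number_def algebra_simps)
  qed
  then have "norm (y t) \<le> Y F c t"
  proof (rule norm_le_scalar_comparison[where a = t0 and b = b and y = y and Y = "Y F c" and t = t, rotated])
    show "continuous_on {t0..b} (\<lambda>t. condition_number (W t) * l t)"
      "continuous_on {t0..b} (\<lambda>t. \<kappa> t * norm (F t))"
      by (rule continuous_on_subset[of "{t0..}"];
          auto intro!: continuous_rate continuous_on_mult[OF continuous_\<kappa>] continuous_on_norm F)+
    show "norm (y t0) \<le> Y F c t0"
      using x by (simp add: y_def c_def Y_def K_def ivp_solution_def)
    show "(y has_vector_derivative matrix_inv (W s) *v (f s (x s) + F s)) (at s within {t0..b})"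
      if "s \<in> {t0..b}" for s
      using that by (intro has_vector_derivative_within_subset[OF y]) auto
    show "(Y F c has_real_derivative condition_number (W s) * l s * Y F c s + \<kappa> s * norm (F s))
        (at s within {t0..b})" if "s \<in> {t0..b}" for s
      using that by (intro DERIV_subset[OF Y_derivative[OF F]]) auto
  qed (use t rate_nonneg in auto)
  then have "\<sigma> t * norm (y t) \<le> \<sigma> t * Y F c t"
    by (intro mult_left_mono) (auto simp: spectral_norm_nonneg)
  then show ?thesis
    using norm_matrix_vector_mult_le[of "W t" "y t"] Wy[of t] t by (simp add: c_def)
qed

text \<open>The Lipschitz bound, from which the estimate follows, is assumed only inside \<open>\<Omega>\<close>, and it is
  the estimate that keeps the solution inside. This circle is broken at the first time \<open>\<tau>\<close> at
  which the solution reaches norm \<open>e\<close>: up to \<open>\<tau>\<close> the solution lies in the closed ball, so the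
  estimate holds at \<open>\<tau>\<close> and puts the norm below \<open>e\<close>, a contradiction.\<close>

lemma solution_le_if_bound_in_\<Omega>:
  assumes \<Omega>: "cball 0 e \<subseteq> \<Omega>"
    and small: "\<And>s. s \<in> {t0..b} \<Longrightarrow> \<sigma> s * Y F (norm (matrix_inv (W t0) *v x0)) s < e"
    and t: "t \<in> {t0..b}"
  shows "norm (x t) \<le> \<sigma> t * Y F (norm (matrix_inv (W t0) *v x0)) t"
proof -
  have cont: "continuous_on {t0..b} (\<lambda>t. norm (x t))"
  proof -
    have "continuous_on {t0..} x"
      unfolding continuous_on_eq_continuous_within
      using x has_vector_derivative_continuous unfolding ivp_solution_def by blast
    then show ?thesis by (auto intro!: continuous_on_norm intro: continuous_on_subset)
  qed
  have initial: "norm (x t0) < e"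
  proof -
    have "x0 = W t0 *v (matrix_inv (W t0) *v x0)"
      using W_invertible[of t0] by (simp add: matrix_vector_mul_assoc invertible_matrix_inv)
    then have "norm x0 \<le> \<sigma> t0 * norm (matrix_inv (W t0) *v x0)"
      using norm_matrix_vector_mult_le by metis
    then show ?thesis
      using small[of t0] t x by (simp add: Y_def K_def ivp_solution_def)
  qed
  have below: "norm (x s) \<le> e" if s: "s \<in> {t0..b}" for s
  proof (rule ccontr)
    define E where "E = {s \<in> {t0..b}. e \<le> norm (x s)}"
    assume "\<not> norm (x s) \<le> e"
    then have nonempty: "E \<noteq> {}" using s by (auto simp: E_def)
    have compact: "compact E"
    proof -
      have "closed E" unfolding E_def
        by (intro continuous_on_closed_Collect_le cont continuous_on_const) auto
      moreover have "bounded E" by (rule bounded_subset[of "{t0..b}"]) (auto simp: E_def)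
      ultimately show ?thesis by (simp add: compact_eq_bounded_closed)
    qed
    obtain \<tau> where \<tau>: "\<tau> \<in> E" and first: "\<And>s. s \<in> E \<Longrightarrow> \<tau> \<le> s"
      using compact_attains_inf[OF compact nonempty] by blast
    have "\<exists>s\<ge>t0. s \<le> \<tau> \<and> norm (x s) = e"
      using \<tau> initial by (intro IVT') (auto simp: E_def intro: continuous_on_subset[OF cont])
    then obtain s where s: "t0 \<le> s" "s \<le> \<tau>" "norm (x s) = e" by blast
    then have "s \<in> E" using \<tau> by (auto simp: E_def)
    then have at_\<tau>: "norm (x \<tau>) = e" using first[of s] s by simp
    have "x r \<in> \<Omega>" if "r \<in> {t0..\<tau>}" for r
    proof (cases "r = \<tau>")
      case True
      then show ?thesis using at_\<tau> \<Omega> by auto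
    next
      case False
      then have "r \<notin> E" using first[of r] that by auto
      then show ?thesis using that \<tau> \<Omega> by (auto simp: E_def)
    qed
    then have "norm (x \<tau>) \<le> \<sigma> \<tau> * Y F (norm (matrix_inv (W t0) *v x0)) \<tau>"
      using \<tau> by (intro solution_le_while_in_\<Omega>[where b = \<tau>]) (auto simp: E_def)
    then show False using small[of \<tau>] \<tau> at_\<tau> by (auto simp: E_def)
  qed
  show ?thesis
    using below \<Omega> t by (intro solution_le_while_in_\<Omega>[where b = b]) auto
qed

end

end

theorem theorem1:
  fixes \<zeta> t0 lhat :: real
    and A W :: "real \<Rightarrow> real ^ 'n ^ 'n"
    and f :: "real \<Rightarrow> real ^ 'n \<Rightarrow> real ^ 'n"
    and \<phi> :: "real \<Rightarrow> real ^ 'n"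
    and l :: "real \<Rightarrow> real"
    and \<Omega>1 N :: "(real ^ 'n) set"
  assumes "t0 \<in> {\<zeta>..}"
    and "continuous_on {t0..} A"
    and "continuous_on ({t0..} \<times> UNIV) (\<lambda>(t, y). f t y)"
    and "\<And>t. t \<ge> t0 \<Longrightarrow> f t 0 = 0"
    and "\<And>t. t \<ge> t0 \<Longrightarrow> norm (\<phi> t) = 1"
    and "0 \<in> interior N"
    and "fundamental_matrix {t0..} A W"
    and "spectral_norm (W t0) = 1"
    and "\<And>t. t \<ge> t0 \<Longrightarrow> simple_singular_value (W t) (sigma_max (W t))"
    and "bounded \<Omega>1" and "0 \<in> interior \<Omega>1"
    and "continuous_on {t0..} l"
    and "\<And>t. t \<ge> t0 \<Longrightarrow> 0 < l t \<and> l t \<le> lhat"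
    and "\<And>t y. t \<ge> t0 \<Longrightarrow> y \<in> \<Omega>1 \<Longrightarrow> norm (f t y) \<le> l t * norm y"
  shows "\<exists>r_max > 0. \<exists>F_max > 0. \<exists>\<delta>_max > 0.
    \<forall>r1 Fhat \<delta>1. 0 < r1 \<and> r1 < r_max \<and> ball 0 r1 \<subseteq> \<Omega>1 \<and>
        0 \<le> Fhat \<and> Fhat < F_max \<and> 0 < \<delta>1 \<and> \<delta>1 < \<delta>_max \<longrightarrow>
    (\<forall>F x. F = (\<lambda>t. Fhat *\<^sub>R \<phi> t) \<and> continuous_on {t0..} F \<and>
        (\<forall>x0\<in>N. unique_ivp_solution {t0..} (\<lambda>t y. A t *v y + f t y + F t) t0 x0
                   (\<lambda>t. x t x0)) \<longrightarrow>
      (\<forall>x0\<in>ball 0 r1. \<exists>X.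
        unique_ivp_solution {t0..}
          (\<lambda>t Y. (log_growth_rate t0 W t + condition_number (W t) * l t) * Y
                  + condition_number (W t) * norm (F t))
          t0 (norm (matrix_inv (W t0) *v x0)) X \<and>
        (\<forall>t\<in>{t0..t0 + \<delta>1}.
          norm (x t x0) \<le> X t \<and> X t = X_h t0 W l x0 t + X_nh t0 W l F t)))"
proof -
  interpret simple_fundamental_solution t0 A W l
    using assms(7,9,12,13) by unfold_locales (auto intro: less_imp_le)
  obtain B where B: "B > 0" and bound: "\<And>F Fhat c t. continuous_on {t0..} F \<Longrightarrow>
      (\<And>\<tau>. \<tau> \<ge> t0 \<Longrightarrow> norm (F \<tau>) \<le> Fhat) \<Longrightarrow> 0 \<le> c \<Longrightarrow> t \<in> {t0..t0 + 1} \<Longrightarrow>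
      \<sigma> t * Y F c t \<le> B * (c + Fhat)"
    using \<sigma>_times_Y_bound by blast
  obtain e where e: "e > 0" "cball 0 e \<subseteq> \<Omega>1"
    using assms(11) mem_interior_cball by blast
  obtain eN where eN: "eN > 0" "ball 0 eN \<subseteq> N"
    using assms(6) mem_interior by blast
  have \<kappa>: "0 \<le> \<kappa> t0" by (rule spectral_norm_nonneg)
  \<comment> \<open>Initial value and forcing each contribute less than \<open>e / (2 * B)\<close>, which keeps the majorant
    below \<open>e\<close>. The summand 1 makes the denominator positive, and \<open>eN\<close> ensures that the solutions
    exist.\<close>
  define r_max where "r_max = min eN (e / (2 * B * (\<kappa> t0 + 1)))"
  define F_max where "F_max = e / (2 * B)"
  have pos: "r_max > 0" "F_max > 0"
    using e(1) eN(1) B \<kappa> by (auto simp: r_max_def F_max_def)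
  have main: "\<exists>X. unique_ivp_solution {t0..}
        (\<lambda>t Y. (p t + condition_number (W t) * l t) * Y + condition_number (W t) * norm (F t))
        t0 (norm (matrix_inv (W t0) *v x0)) X \<and>
      (\<forall>t\<in>{t0..t0 + \<delta>1}. norm (x t x0) \<le> X t \<and> X t = X_h t0 W l x0 t + X_nh t0 W l F t)"
    if r1: "r1 < r_max" and Fhat: "0 \<le> Fhat" "Fhat < F_max" and \<delta>1: "\<delta>1 < 1"
      and F: "F = (\<lambda>t. Fhat *\<^sub>R \<phi> t)" "continuous_on {t0..} F"
      and x: "\<forall>x0\<in>N. unique_ivp_solution {t0..} (\<lambda>t y. A t *v y + f t y + F t) t0 x0 (\<lambda>t. x t x0)"
      and x0: "x0 \<in> ball 0 r1" for r1 Fhat \<delta>1 F x x0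
  proof -
    define c where "c = norm (matrix_inv (W t0) *v x0)"
    have "x0 \<in> N" using x0 r1 eN(2) by (auto simp: r_max_def)
    then have sol: "ivp_solution {t0..} (\<lambda>t y. A t *v y + f t y + F t) t0 x0 (\<lambda>t. x t x0)"
      using x by (simp add: unique_ivp_solution_def)
    have F_le: "norm (F \<tau>) \<le> Fhat" if "\<tau> \<ge> t0" for \<tau>
      using assms(5)[OF that] Fhat(1) by (simp add: F(1))
    have "c \<le> \<kappa> t0 * norm x0" unfolding c_def by (rule norm_matrix_vector_mult_le)
    also have "\<dots> \<le> (\<kappa> t0 + 1) * norm x0" by (intro mult_right_mono) auto
    also have "\<dots> < (\<kappa> t0 + 1) * (e / (2 * B * (\<kappa> t0 + 1)))"
      using x0 r1 \<kappa> by (intro mult_strict_left_mono) (auto simp: r_max_def)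
    also have "\<dots> = e / (2 * B)" using \<kappa> by (simp add: divide_simps)
    finally have "c + Fhat < e / (2 * B) + e / (2 * B)"
      using Fhat(2) by (simp add: F_max_def)
    then have "B * (c + Fhat) < e" using B by (simp add: field_simps)
    then have small: "\<sigma> t * Y F c t < e" if "t \<in> {t0..t0 + \<delta>1}" for t
      using bound[OF F(2) F_le, of c t] that \<delta>1 by (auto simp: c_def)
    show ?thesis
    proof (intro exI conjI ballI)
      show "unique_ivp_solution {t0..}
          (\<lambda>t Y. (p t + condition_number (W t) * l t) * Y + condition_number (W t) * norm (F t))
          t0 (norm (matrix_inv (W t0) *v x0)) (\<lambda>t. \<sigma> t * Y F c t)"
        unfolding c_def by (rule unique_ivp_solution_\<sigma>_times_Y[OF F(2) assms(8)])
      fix t assume t: "t \<in> {t0..t0 + \<delta>1}"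
      show "norm (x t x0) \<le> \<sigma> t * Y F c t"
        using solution_le_if_bound_in_\<Omega>[OF F(2) sol assms(14) e(2) small[unfolded c_def] t]
        by (simp add: c_def)
      show "\<sigma> t * Y F c t = X_h t0 W l x0 t + X_nh t0 W l F t"
        using X_eq_\<sigma>_times_Y t by (simp add: c_def)
    qed
  qed
  show ?thesis
    \<comment> \<open>The constant \<open>B\<close> covers the time interval up to \<open>t0 + 1\<close>, so the bound on \<open>\<delta>1\<close> is 1.\<close>
    by (rule exI[of _ r_max], rule conjI[OF pos(1)], rule exI[of _ F_max], rule conjI[OF pos(2)],
        rule exI[of _ 1], rule conjI[OF zero_less_one]) (use main in blast)
qed

end
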